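(* Let $F_X$ and $F_Y$ be two cdfs on $\mathbb{R}$, and let $A_0=\{u\in(0,1): F_X^{\leftarrow}(u)>F_Y^{\leftarrow}(u)\}$. Let $s\in\mathbb{N}$ and let $\boldsymbol{w}=(w_1,\ldots,w_s)\in(0,1)^s$ with $\sum_{i=1}^s w_i=1$ (with $w_1=1$ when $s=1$). For every $\alpha>0$ let $0<r_1<r_2<\cdots<r_s<\alpha+1$, where the $r_i$ may depend on $\alpha$; let $\lambda_i=\lim_{\alpha\to\infty}\frac{r_i}{\alpha+1}$ for $i=1,\ldots,s$, and assume that $\lambda_1<\lambda_2<\cdots<\lambda_s$. For every $\alpha>0$ let $X_{\boldsymbol{w},\boldsymbol{r},\alpha}$ and $Y_{\boldsymbol{w},\boldsymbol{r},\alpha}$ be random variables with respective cdfs $$F_{X_{\boldsymbol{w},\boldsymbol{r},\alpha}}(x)=\sum_{i=1}^s w_i\,\phi_{r_i,\alpha}(F_X(x)),\qquad F_{Y_{\boldsymbol{w},\boldsymbol{r},\alpha}}(x)=\sum_{i=1}^s w_i\,\phi_{r_i,\alpha}(F_Y(x)),\qquad x\in\mathbb{R}.$$ Assume that each $\lambda_i$ is separated from $A_0$ by a positive distance, i.e. $$\min_{i\in\{1,2,\ldots,s\}}\mathrm{dist}(\lambda_i,A_0)>0.$$ Then $X_{\boldsymbol{w},\boldsymbol{r},\alpha}\leq_{\mathrm{ast}} Y_{\boldsymbol{w},\boldsymbol{r},\alpha}$, as $\alpha\to\infty$. Furthermore, $X_{\boldsymbol{w},\boldsymbol{r},\alpha}\leq_{\mathrm{asp}}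 Y_{\boldsymbol{w},\boldsymbol{r},\alpha}$, as $\alpha\to\infty$, if $X$ and $Y$ are independent (that is, $X_{\boldsymbol{w},\boldsymbol{r},\alpha}$ and $Y_{\boldsymbol{w},\boldsymbol{r},\alpha}$ are independent for every $\alpha>0$).
   Context: $X$ and $Y$ denote the parent variables with cdfs $F_X$ and $F_Y$. For a cdf $F$, $F^{\leftarrow}(u)=\inf\{x\in\mathbb{R}: F(x)\ge u\}$ for $u\in(0,1)$; $\mu$ is Lebesgue measure; $\mathrm{dist}(x,S)=\inf_{y\in S}|x-y|$ (with $\inf\emptyset=+\infty$). For $\alpha>0$ and $0<r<\alpha+1$, $\phi_{r,\alpha}(u)=\frac{1}{B(r,\alpha-r+1)}\int_0^u v^{r-1}(1-v)^{\alpha-r}\,dv$, $u\in[0,1]$, where $B$ is the Beta function. The $r$th order statistic from a sample of (possibly non-integral) size $\alpha$ from a distribution with cdf $F$ is a random variable with cdf $\phi_{r,\alpha}(F(x))$; thus $X_{\boldsymbol{w},\boldsymbol{r},\alpha}$ and $Y_{\boldsymbol{w},\boldsymbol{r},\alpha}$ are mixtures of order statistics. For families of random variables $U_\alpha$, $V_\alpha$ ($\alpha>0$) with cdfs $F_{U_\alpha},F_{V_\alpha}$: $U_\alpha\leq_{\mathrm{ast}}V_\alpha$, as $\alpha\to\infty$, means $\lim_{\alpha\to\infty}\mu(\{u\in(0,1): F_{U_\alpha}^{\leftarrow}(u)>F_{V_\alpha}^{\leftarrow}(u)\})=0$; $U_\alpha\leq_{\mathrm{asp}}V_\alpha$, as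 $\alpha\to\infty$, means $\lim_{\alpha\to\infty}P\{U_\alpha\le V_\alpha\}\ge 1/2$.
   Formalization: In the relation ≤_asp the condition lim P{U_α ≤ V_α} ≥ 1/2 is replaced by liminf P{U_α ≤ V_α} ≥ 1/2, because the limit need not exist (e.g. Bernoulli(1/2) parents with s = 1 and oscillating r_1); the two agree whenever the limit exists. *)

theory Defs
  imports "HOL-Probability.Probability"
begin

definition is_cdf :: "(real \<Rightarrow> real) \<Rightarrow> bool" where
  "is_cdf F \<longleftrightarrow> (\<exists>D. real_distribution D \<and> F = cdf D)"

text \<open>Only meaningful for \<open>0 < u < 1\<close> and a cdf \<open>F\<close>, where the set is nonempty and bounded below.\<close>

definition quantile :: "(real \<Rightarrow> real) \<Rightarrow> real \<Rightarrow> real" where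
  "quantile F u = Inf {x. F x \<ge> u}"

definition quantile_excess :: "(real \<Rightarrow> real) \<Rightarrow> (real \<Rightarrow> real) \<Rightarrow> real set" where
  "quantile_excess F G = {u \<in> {0<..<1}. quantile F u > quantile G u}"

text \<open>Extended-real valued, so that the distance to the empty set is \<open>\<infinity>\<close>
  (the library's \<open>infdist\<close> gives 0 there).\<close>

definition dist_to_set :: "real \<Rightarrow> real set \<Rightarrow> ereal" where
  "dist_to_set x S = (INF y\<in>S. ereal \<bar>x - y\<bar>)"

text \<open>For \<open>0 < r < \<alpha> + 1\<close> this is the cdf on \<open>[0,1]\<close> of the Beta distribution with parameters
  \<open>r\<close> and \<open>\<alpha> - r + 1\<close>. The integrand may be unbounded at 0 or 1; the endpoint values
  given by \<open>0 powr _ = 0\<close> do not affect the Lebesgue integral.\<close>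

definition phi :: "real \<Rightarrow> real \<Rightarrow> real \<Rightarrow> real" where
  "phi r \<alpha> u =
     1 / Beta r (\<alpha> - r + 1) * (LBINT v:{0..u}. v powr (r - 1) * (1 - v) powr (\<alpha> - r))"

definition rv_cdf :: "'a measure \<Rightarrow> ('a \<Rightarrow> real) \<Rightarrow> real \<Rightarrow> real" where
  "rv_cdf M X = cdf (distr M borel X)"

text \<open>The families are indexed by real \<open>\<alpha> > 0\<close>; the probability space may vary with \<open>\<alpha>\<close>.\<close>

definition ast_le ::
  "(real \<Rightarrow> 'a measure) \<Rightarrow> (real \<Rightarrow> 'a \<Rightarrow> real) \<Rightarrow> (real \<Rightarrow> 'a \<Rightarrow> real) \<Rightarrow> bool" where
  "ast_le M U V \<longleftrightarrow>
     ((\<lambda>\<alpha>. measure lebesgue (quantile_excess (rv_cdf (M \<alpha>) (U \<alpha>)) (rv_cdf (M \<alpha>) (V \<alpha>))))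
        \<longlongrightarrow> 0) at_top"

text \<open>The condition \<open>lim P(U \<le> V) \<ge> 1/2\<close> is expressed with the lower limit, which coincides with the
  limit whenever the latter exists. It need not exist for mixtures of order statistics: if
  both parents are Bernoulli(1/2), \<open>s = 1\<close> and
  \<open>r = (\<alpha> + 1) / 2 + sin \<alpha> * sqrt (\<alpha> + 1) / 2\<close>, then the probability oscillates as \<open>\<alpha> \<rightarrow> \<infinity>\<close>.\<close>

definition asp_le ::
  "(real \<Rightarrow> 'a measure) \<Rightarrow> (real \<Rightarrow> 'a \<Rightarrow> real) \<Rightarrow> (real \<Rightarrow> 'a \<Rightarrow> real) \<Rightarrow> bool" where
  "asp_le M U V \<longleftrightarrow>
     Liminf at_top (\<lambda>\<alpha>. ereal (measure (M \<alpha>) {\<omega> \<in> space (M \<alpha>). U \<alpha> \<omega> \<le> V \<alpha> \<omega>})) \<ge> ereal (1 / 2)"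

end

theory Submission
  imports Defs "HOL-Real_Asymp.Real_Asymp"
begin

text \<open>
  Let \<open>G\<close> be the mixture of the functions \<open>phi (r i) \<alpha>\<close> with weights \<open>w i\<close>, so that the two
  mixtures have the cdfs \<open>G \<circ> F\<^sub>X\<close> and \<open>G \<circ> F\<^sub>Y\<close>. A Beta variable with parameters \<open>r\<close> and
  \<open>\<alpha> - r + 1\<close> has mean \<open>r / (\<alpha> + 1)\<close> and variance at most \<open>1 / (\<alpha> + 2)\<close>, so by Chebyshev's
  inequality \<open>phi (r i) \<alpha>\<close> approaches the indicator of \<open>{lam i..1}\<close>, uniformly outside every
  neighbourhood of \<open>lam i\<close>. Hence \<open>G\<close> is, up to a small error \<open>\<tau>\<close>, constant on every interval
  that stays at distance \<open>d\<close> from all \<open>lam i\<close>, and the constant is the sum of the weights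
  over some set \<open>J\<close> of indices.

  Such intervals are exactly what the hypothesis provides. By the Galois connection between
  cdfs and quantiles, \<open>quantile_excess F G\<close> is the union over \<open>x\<close> of the intervals
  \<open>{F x<..G x}\<close> (cut to \<open>{0<..<1}\<close>), see \<open>mem_quantile_excess_iff\<close>. So if the cdf of the
  \<open>Y\<close>-mixture exceeds that of the \<open>X\<close>-mixture at \<open>x\<close>, then \<open>F\<^sub>X x < F\<^sub>Y x\<close>, the whole interval
  between these values belongs to the excess set of the parents, and both mixture cdfs at \<open>x\<close>
  lie within \<open>\<tau>\<close> of one of the finitely many numbers \<open>sum w J\<close>
  (\<open>phi_mixture_almost_constant\<close>). This has two consequences.

  The excess set of the mixtures is covered by the \<open>2 ^ s\<close> intervals of radius \<open>\<tau>\<close> around the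
  numbers \<open>sum w J\<close>, so its measure tends to 0 with \<open>\<tau>\<close>. And the cdf of the \<open>X\<close>-mixture is
  everywhere at least that of the \<open>Y\<close>-mixture minus \<open>2 * \<tau>\<close>. Under independence
  \<open>P(X \<le> Y)\<close> is the expectation of the cdf of \<open>X\<close> at \<open>Y\<close>, hence at least \<open>P(Y' \<le> Y) - 2 * \<tau>\<close>
  for an independent copy \<open>Y'\<close> of \<open>Y\<close>, and \<open>P(Y' \<le> Y) \<ge> 1 / 2\<close> by symmetry
  (\<open>indep_prob_le_ge\<close>).
\<close>

section \<open>Quantiles and cdfs\<close>

lemma quantile_le_iff:
  assumes "is_cdf F" "0 < u" "u < 1"
  shows "quantile F u \<le> x \<longleftrightarrow> u \<le> F x"
proof -
  obtain D where D: "real_distribution D" and F: "F = cdf D"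
    using assms(1) by (auto simp: is_cdf_def)
  interpret cdf_distribution D
    using D by (simp add: cdf_distribution_def)
  show ?thesis
    using pseudoinverse[OF assms(2,3), of x] by (simp add: F quantile_def)
qed

text \<open>A witness \<open>x\<close> is the smaller of the two quantiles, at which \<open>G\<close> has already reached level
  \<open>u\<close> and \<open>F\<close> has not. Trading quantiles for cdf values in this way makes it possible to work
  with the composition of \<open>phi\<close> and a parent cdf without inverting \<open>phi\<close>.\<close>

lemma mem_quantile_excess_iff:
  assumes "is_cdf F" "is_cdf G"
  shows "u \<in> quantile_excess F G \<longleftrightarrow> 0 < u \<and> u < 1 \<and> (\<exists>x. F x < u \<and> u \<le> G x)"
proof (cases "0 < u \<and> u < 1")
  case True
  then have F: "quantile F u \<le> x \<longleftrightarrow> u \<le> F x" and G: "quantile G u \<le> x \<longleftrightarrow> u \<le> G x" for x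
    using quantile_le_iff assms by blast+
  have "quantile G u < quantile F u \<longleftrightarrow> (\<exists>x. F x < u \<and> u \<le> G x)"
    by (metis F G not_less order.refl order.strict_trans2)
  then show ?thesis
    using True by (auto simp: quantile_excess_def)
qed (auto simp: quantile_excess_def)

lemma is_cdf_bounds:
  assumes "is_cdf F"
  shows "0 \<le> F x" "F x \<le> 1"
proof -
  obtain D where D: "real_distribution D" and F: "F = cdf D"
    using assms by (auto simp: is_cdf_def)
  interpret real_distribution D by (rule D)
  show "0 \<le> F x" "F x \<le> 1"
    by (simp_all add: F cdf_nonneg cdf_bounded_prob)
qed

lemma real_distribution_distr_borel:
  assumes "prob_space M" "X \<in> borel_measurable M"
  shows "real_distribution (distr M borel X)"
  using prob_space.prob_space_distr[OF assms]
  by (simp add: real_distribution_def real_distribution_axioms_def)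

lemma is_cdf_rv_cdf:
  assumes "prob_space M" "X \<in> borel_measurable M"
  shows "is_cdf (rv_cdf M X)"
  using real_distribution_distr_borel[OF assms] by (auto simp: is_cdf_def rv_cdf_def)

section \<open>Concentration of the Beta distribution\<close>

lemma set_integral_Beta:
  fixes a b :: real
  assumes "a > 0" "b > 0"
  shows "(LBINT v:{0..1}. v powr (a - 1) * (1 - v) powr (b - 1)) = Beta a b"
  using set_borel_integral_eq_integral(2)[OF integrable_Beta[OF assms]]
    has_integral_Beta_real[OF assms] by (simp add: integral_unique)

lemma Beta_pos:
  fixes a b :: real
  assumes "a > 0" "b > 0"
  shows "Beta a b > 0"
  using assms by (simp add: Beta_def)

text \<open>Expanding the square turns the integral into a combination of Beta integrals with first
  parameter \<open>a\<close>, \<open>a + 1\<close> and \<open>a + 2\<close>, which the recurrence of the Beta function reduces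
  to \<open>Beta a b\<close>.\<close>

lemma Beta_second_central_moment:
  fixes a b :: real
  assumes a: "a > 0" and b: "b > 0"
  defines "m \<equiv> a / (a + b)"
  shows "set_integrable lborel {0..1} (\<lambda>v. (v - m)\<^sup>2 * (v powr (a - 1) * (1 - v) powr (b - 1)))"
    and "(LBINT v:{0..1}. (v - m)\<^sup>2 * (v powr (a - 1) * (1 - v) powr (b - 1)))
           = Beta a b * (a * b / ((a + b)\<^sup>2 * (a + b + 1)))"
proof -
  let ?f = "\<lambda>k v. v powr (a + k - 1) * (1 - v) powr (b - 1)"
  let ?g = "\<lambda>v. ?f 2 v - 2 * m * ?f 1 v + m\<^sup>2 * ?f 0 v"
  have int: "set_integrable lborel {0..1} (?f k)" and
    val: "(LBINT v:{0..1}. ?f k v) = Beta (a + k) b" if "k \<ge> 0" for k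
    using integrable_Beta[of "a + k" b] set_integral_Beta[of "a + k" b] a b that by auto
  have eq: "(v - m)\<^sup>2 * (v powr (a - 1) * (1 - v) powr (b - 1)) = ?g v" if "v \<in> {0..1}" for v
    \<comment> \<open>At 0 both sides vanish because \<open>0 powr _ = 0\<close>; elsewhere powers may be divided out.\<close>
  proof (cases "v = 0")
    case False
    then have "v > 0" using that by auto
    then have "v powr a = v * v powr (a - 1)" "v powr (a + 1) = v\<^sup>2 * v powr (a - 1)"
      by (simp_all add: powr_diff powr_add power2_eq_square)
    then show ?thesis by (simp add: power2_eq_square algebra_simps)
  qed simp
  have ig: "set_integrable lborel {0..1} ?g"
    by (intro set_integral_add set_integral_diff set_integrable_mult_right int) auto
  then show "set_integrable lborel {0..1} (\<lambda>v. (v - m)\<^sup>2 * (v powr (a - 1) * (1 - v) powr (b - 1)))"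
    by (subst set_integrable_cong[OF refl refl eq]) auto
  have "(LBINT v:{0..1}. (v - m)\<^sup>2 * (v powr (a - 1) * (1 - v) powr (b - 1))) = (LBINT v:{0..1}. ?g v)"
    by (rule set_lebesgue_integral_cong) (use eq in auto)
  also have "\<dots> = Beta (a + 2) b - 2 * m * Beta (a + 1) b + m\<^sup>2 * Beta a b"
    using int[of 2] int[of 1] int[of 0] val[of 2] val[of 1] val[of 0]
    by (simp add: set_integral_add set_integral_diff)
  also have "\<dots> = Beta a b * (a * b / ((a + b)\<^sup>2 * (a + b + 1)))"
  proof -
    have nonpos: "z \<notin> \<int>\<^sub>\<le>\<^sub>0" if "z > 0" for z :: real
      using that by (auto elim!: nonpos_Ints_cases')
    have B1: "Beta (a + 1) b = Beta a b * a / (a + b)"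
      using Beta_plus1_left[of a b] a b by (simp add: field_simps nonpos)
    have "Beta (a + 2) b = Beta (a + 1) b * (a + 1) / (a + b + 1)"
      using Beta_plus1_left[of "a + 1" b] a b by (simp add: field_simps nonpos)
    then have B2: "Beta (a + 2) b = Beta a b * (a / (a + b)) * ((a + 1) / (a + b + 1))"
      by (simp add: B1)
    have "a / n * ((a + 1) / (n + 1)) - 2 * (a / n) * (a / n) + (a / n)\<^sup>2
            = a * (n - a) / (n\<^sup>2 * (n + 1))" if "n > 0" for n
      using that by (simp add: divide_simps power2_eq_square) (simp add: algebra_simps)
    from this[of "a + b"] have "Beta a b * (a / (a + b) * ((a + 1) / (a + b + 1))
        - 2 * (a / (a + b)) * (a / (a + b)) + (a / (a + b))\<^sup>2)
      = Beta a b * (a * b / ((a + b)\<^sup>2 * (a + b + 1)))"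
      using a b by simp
    then show ?thesis
      unfolding B1 B2 m_def by (simp add: algebra_simps)
  qed
  finally show "(LBINT v:{0..1}. (v - m)\<^sup>2 * (v powr (a - 1) * (1 - v) powr (b - 1)))
           = Beta a b * (a * b / ((a + b)\<^sup>2 * (a + b + 1)))" .
qed

text \<open>Chebyshev's inequality for the unnormalised Beta density: multiply by
  \<open>c\<^sup>2 \<le> (v - a / (a + b))\<^sup>2\<close> on \<open>S\<close>, extend the integral to \<open>{0..1}\<close>, and bound the factor
  \<open>a * b / (a + b)\<^sup>2\<close> of the variance by 1.\<close>

lemma Beta_chebyshev:
  fixes a b c :: real
  assumes a: "a > 0" and b: "b > 0" and c: "c > 0"
    and S: "S \<in> sets lborel" "S \<subseteq> {0..1}" "\<And>v. v \<in> S \<Longrightarrow> c \<le> \<bar>v - a / (a + b)\<bar>"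
  shows "(LBINT v:S. v powr (a - 1) * (1 - v) powr (b - 1)) \<le> Beta a b / (c\<^sup>2 * (a + b + 1))"
proof -
  let ?f = "\<lambda>v. v powr (a - 1) * (1 - v) powr (b - 1)"
  let ?m = "a / (a + b)"
  note int = integrable_Beta[OF a b]
  note mom = Beta_second_central_moment[OF a b]
  have "c\<^sup>2 * (LBINT v:S. ?f v) = (LBINT v:S. c\<^sup>2 * ?f v)"
    by simp
  also have "\<dots> \<le> (LBINT v:S. (v - ?m)\<^sup>2 * ?f v)"
  proof (rule set_integral_mono)
    show "set_integrable lborel S (\<lambda>v. c\<^sup>2 * ?f v)"
      by (intro set_integrable_mult_right set_integrable_subset[OF int S(1,2)])
    show "set_integrable lborel S (\<lambda>v. (v - ?m)\<^sup>2 * ?f v)"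
      by (rule set_integrable_subset[OF mom(1) S(1,2)])
    show "c\<^sup>2 * ?f v \<le> (v - ?m)\<^sup>2 * ?f v" if "v \<in> S" for v
      using S(3)[OF that] c
      by (intro mult_right_mono) (auto simp flip: abs_le_square_iff)
  qed
  also have "\<dots> \<le> (LBINT v:{0..1}. (v - ?m)\<^sup>2 * ?f v)"
    unfolding set_lebesgue_integral_def
    using mom(1) set_integrable_subset[OF mom(1) S(1,2)] S(2)
    by (intro integral_mono) (auto simp: set_integrable_def split: split_indicator)
  also have "\<dots> = Beta a b * (a * b / (a + b)\<^sup>2) / (a + b + 1)"
    using mom(2) by simp
  also have "\<dots> \<le> Beta a b * 1 / (a + b + 1)"
  proof (intro divide_right_mono mult_left_mono)
    show "a * b / (a + b)\<^sup>2 \<le> 1"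
    proof -
      have "a * b \<le> (a + b)\<^sup>2" using a b by (simp add: power2_sum)
      then show ?thesis using a b by (simp add: divide_le_eq)
    qed
  qed (use Beta_pos[OF a b] a b in auto)
  finally have "c\<^sup>2 * (LBINT v:S. ?f v) \<le> Beta a b / (a + b + 1)"
    by simp
  then show ?thesis
    using c by (simp add: pos_le_divide_eq mult.commute flip: divide_divide_eq_left)
qed

lemma phi_split:
  assumes "0 < r" "r < \<alpha> + 1" "0 \<le> s" "s \<le> t" "t \<le> 1"
  shows "phi r \<alpha> t = phi r \<alpha> s
    + (LBINT v:{s<..t}. v powr (r - 1) * (1 - v) powr (\<alpha> - r)) / Beta r (\<alpha> - r + 1)"
proof -
  let ?f = "\<lambda>v. v powr (r - 1) * (1 - v) powr (\<alpha> - r)"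
  have int: "set_integrable lborel {0..1} ?f"
    using integrable_Beta[of r "\<alpha> - r + 1"] assms by simp
  have "{0..t} = {0..s} \<union> {s<..t}" using assms by auto
  then have "(LBINT v:{0..t}. ?f v) = (LBINT v:{0..s}. ?f v) + (LBINT v:{s<..t}. ?f v)"
    by (simp, intro set_integral_Un set_integrable_subset[OF int]) (use assms in auto)
  then show ?thesis
    by (simp add: phi_def add_divide_distrib)
qed

lemma
  assumes "0 < r" "r < \<alpha> + 1"
  shows phi_0: "phi r \<alpha> 0 = 0" and phi_1: "phi r \<alpha> 1 = 1"
proof -
  show "phi r \<alpha> 0 = 0"
    by (auto simp: phi_def set_lebesgue_integral_def intro!: integral_eq_zero_AE
        AE_I[where N = "{0}"] split: split_indicator)
  show "phi r \<alpha> 1 = 1"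
    using set_integral_Beta[of r "\<alpha> - r + 1"] Beta_pos[of r "\<alpha> - r + 1"] assms
    by (simp add: phi_def)
qed

lemma phi_mono:
  assumes "0 < r" "r < \<alpha> + 1" "0 \<le> s" "s \<le> t" "t \<le> 1"
  shows "phi r \<alpha> s \<le> phi r \<alpha> t"
proof -
  have "0 \<le> (LBINT v:{s<..t}. v powr (r - 1) * (1 - v) powr (\<alpha> - r))"
    unfolding set_lebesgue_integral_def by (intro Bochner_Integration.integral_nonneg) (auto split: split_indicator)
  then show ?thesis
    using phi_split[OF assms] Beta_pos[of r "\<alpha> - r + 1"] assms by simp
qed

lemma phi_bounds:
  assumes "0 < r" "r < \<alpha> + 1" "0 \<le> t" "t \<le> 1"
  shows "0 \<le> phi r \<alpha> t" "phi r \<alpha> t \<le> 1"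
  using phi_mono[of r \<alpha> 0 t] phi_mono[of r \<alpha> t 1] phi_0[of r \<alpha>] phi_1[of r \<alpha>] assms by auto

text \<open>The uniform concentration estimate: used with \<open>s = 0\<close> it bounds the lower tail of the Beta
  distribution, and with \<open>t = 1\<close> the upper tail.\<close>

lemma phi_increment_le:
  assumes r: "0 < r" "r < \<alpha> + 1" and t: "0 \<le> s" "s \<le> t" "t \<le> 1" and c: "c > 0"
    and away: "\<And>v. v \<in> {s<..t} \<Longrightarrow> c \<le> \<bar>v - r / (\<alpha> + 1)\<bar>"
  shows "phi r \<alpha> t - phi r \<alpha> s \<le> 1 / (c\<^sup>2 * (\<alpha> + 2))"
proof -
  let ?B = "Beta r (\<alpha> - r + 1)"
  have B: "?B > 0"
    using Beta_pos[of r "\<alpha> - r + 1"] r by simp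
  have "{s<..t} \<subseteq> {0..1}"
    using t by auto
  then have "(LBINT v:{s<..t}. v powr (r - 1) * (1 - v) powr (\<alpha> - r)) \<le> ?B / (c\<^sup>2 * (\<alpha> + 2))"
    using Beta_chebyshev[of r "\<alpha> - r + 1" c "{s<..t}"] r c away by (simp add: add.assoc)
  then have "(LBINT v:{s<..t}. v powr (r - 1) * (1 - v) powr (\<alpha> - r)) / ?B
      \<le> ?B / (c\<^sup>2 * (\<alpha> + 2)) / ?B"
    using B by (intro divide_right_mono) auto
  then show ?thesis
    using phi_split[OF r t] B by simp
qed

section \<open>Mixtures are almost constant away from their limiting quantile levels\<close>

lemma interval_avoids_ball:
  fixes p q l d :: real
  assumes "p < q" "d > 0" "\<And>v. p < v \<Longrightarrow> v < q \<Longrightarrow> d \<le> \<bar>l - v\<bar>"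
  shows "q \<le> l - d \<or> l + d \<le> p"
proof (rule ccontr)
  assume "\<not> ?thesis"
  then have "max p (l - d) < min q (l + d)"
    using assms(1,2) by auto
  then obtain v where "max p (l - d) < v" "v < min q (l + d)"
    using dense by blast
  then show False
    using assms(3)[of v] by auto
qed

text \<open>Each component has either not started to rise at the right end \<open>q\<close> or has completed its
  rise at the left end \<open>p\<close>; \<open>J\<close> collects the components of the second kind. Since the weights
  sum to 1, the errors \<open>\<tau>\<close> of the components average to an error \<open>\<tau>\<close>. The two estimates
  point outwards, so for monotone components they enclose the values on the whole interval.\<close>

lemma weighted_sum_almost_constant:
  fixes f :: "'i \<Rightarrow> real \<Rightarrow> real" and w :: "'i \<Rightarrow> real"
  assumes fin: "finite I" and w: "\<And>i. i \<in> I \<Longrightarrow> 0 \<le> w i" "sum w I = 1" and "0 \<le> \<tau>"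
    and bounds: "\<And>i. i \<in> I \<Longrightarrow> 0 \<le> f i p" "\<And>i. i \<in> I \<Longrightarrow> f i q \<le> 1"
    and dichotomy: "\<And>i. i \<in> I \<Longrightarrow> f i q \<le> \<tau> \<or> 1 - \<tau> \<le> f i p"
  shows "\<exists>J\<subseteq>I. sum w J - \<tau> \<le> (\<Sum>i\<in>I. w i * f i p) \<and> (\<Sum>i\<in>I. w i * f i q) \<le> sum w J + \<tau>"
proof (intro exI conjI)
  define J where "J = {i \<in> I. 1 - \<tau> \<le> f i p}"
  show "J \<subseteq> I" by (auto simp: J_def)
  have wJ: "sum w J = (\<Sum>i\<in>I. w i * of_bool (i \<in> J))"
    using fin by (simp add: J_def sum.inter_filter of_bool_def if_distrib cong: if_cong)
  have "sum w J - \<tau> = (\<Sum>i\<in>I. w i * (of_bool (i \<in> J) - \<tau>))"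
    using w(2) by (simp add: wJ right_diff_distrib sum_subtractf flip: sum_distrib_right)
  also have "\<dots> \<le> (\<Sum>i\<in>I. w i * f i p)"
  proof (intro sum_mono mult_left_mono w(1))
    show "of_bool (i \<in> J) - \<tau> \<le> f i p" if "i \<in> I" for i
      using bounds(1)[OF that] \<open>0 \<le> \<tau>\<close> that by (simp add: J_def)
  qed
  finally show "sum w J - \<tau> \<le> (\<Sum>i\<in>I. w i * f i p)" .
  have "(\<Sum>i\<in>I. w i * f i q) \<le> (\<Sum>i\<in>I. w i * (of_bool (i \<in> J) + \<tau>))"
    using bounds(2) dichotomy \<open>0 \<le> \<tau>\<close>
    by (intro sum_mono mult_left_mono w(1)) (force simp: J_def)+
  also have "\<dots> = sum w J + \<tau>"
    using w(2) by (simp add: wJ distrib_left sum.distrib flip: sum_distrib_right)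
  finally show "(\<Sum>i\<in>I. w i * f i q) \<le> sum w J + \<tau>" .
qed

text \<open>If the open interval between \<open>p\<close> and \<open>q\<close> stays at distance \<open>d\<close> from \<open>lam i\<close>, then it lies
  entirely on one side of the ball around \<open>lam i\<close>, so that \<open>{0..q}\<close> or \<open>{p..1}\<close> is a tail at
  distance \<open>d / 2\<close> from the mean \<open>r i / (\<alpha> + 1)\<close> of the Beta distribution. Using
  \<open>c = d / 2\<close> in Chebyshev's inequality explains the value of \<open>\<tau>\<close>.\<close>

lemma phi_mixture_almost_constant:
  fixes w r lam :: "'i \<Rightarrow> real"
  assumes I: "finite I" and w: "\<And>i. i \<in> I \<Longrightarrow> 0 \<le> w i" "sum w I = 1" and "\<alpha> > 0"
    and r: "\<And>i. i \<in> I \<Longrightarrow> 0 < r i" "\<And>i. i \<in> I \<Longrightarrow> r i < \<alpha> + 1"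
    and d: "d > 0" and close: "\<And>i. i \<in> I \<Longrightarrow> \<bar>r i / (\<alpha> + 1) - lam i\<bar> < d / 2"
    and pq: "0 \<le> p" "p < q" "q \<le> 1"
    and far: "\<And>i v. i \<in> I \<Longrightarrow> p < v \<Longrightarrow> v < q \<Longrightarrow> d \<le> \<bar>lam i - v\<bar>"
  defines "\<tau> \<equiv> 4 / (d\<^sup>2 * (\<alpha> + 2))"
  shows "\<exists>J\<subseteq>I. sum w J - \<tau> \<le> (\<Sum>i\<in>I. w i * phi (r i) \<alpha> p)
                 \<and> (\<Sum>i\<in>I. w i * phi (r i) \<alpha> q) \<le> sum w J + \<tau>"
proof (rule weighted_sum_almost_constant[OF I w])
  show "0 \<le> \<tau>"
    using \<open>\<alpha> > 0\<close> by (simp add: \<tau>_def)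
  fix i assume i: "i \<in> I"
  show "0 \<le> phi (r i) \<alpha> p" "phi (r i) \<alpha> q \<le> 1"
    using phi_bounds[OF r(1)[OF i] r(2)[OF i]] pq by auto
  have \<tau>: "1 / ((d / 2)\<^sup>2 * (\<alpha> + 2)) = \<tau>"
    by (simp add: \<tau>_def power_divide)
  consider "q \<le> lam i - d" | "lam i + d \<le> p"
    using interval_avoids_ball[OF pq(2) d far[OF i]] by blast
  then show "phi (r i) \<alpha> q \<le> \<tau> \<or> 1 - \<tau> \<le> phi (r i) \<alpha> p"
  proof cases
    case 1
    then have "phi (r i) \<alpha> q - phi (r i) \<alpha> 0 \<le> 1 / ((d / 2)\<^sup>2 * (\<alpha> + 2))"
      using pq d close[OF i]
      by (intro phi_increment_le r i) (simp_all only: greaterThanAtMost_iff, linarith+)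
    then show ?thesis
      using phi_0[OF r(1)[OF i] r(2)[OF i]] \<tau> by simp
  next
    case 2
    then have "phi (r i) \<alpha> 1 - phi (r i) \<alpha> p \<le> 1 / ((d / 2)\<^sup>2 * (\<alpha> + 2))"
      using pq d close[OF i]
      by (intro phi_increment_le r i) (simp_all only: greaterThanAtMost_iff, linarith+)
    then show ?thesis
      using phi_1[OF r(1)[OF i] r(2)[OF i]] \<tau> by simp
  qed
qed

section \<open>The two comparisons at a fixed sample size\<close>

lemma measure_le_UN_intervals:
  fixes c :: "'j \<Rightarrow> real" and \<tau> :: real
  assumes K: "finite K" and S: "S \<subseteq> (\<Union>j\<in>K. {c j - \<tau>..c j + \<tau>})" and "0 \<le> \<tau>"
  shows "measure lebesgue S \<le> card K * (2 * \<tau>)"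
  \<comment> \<open>The measure of a set outside the \<open>\<sigma>\<close>-algebra is 0 by convention.\<close>
proof (cases "S \<in> sets lebesgue")
  case True
  have "measure lebesgue S \<le> measure lebesgue (\<Union>j\<in>K. {c j - \<tau>..c j + \<tau>})"
    using K by (intro measure_mono_fmeasurable[OF S True] fmeasurable.finite_UN) auto
  also have "\<dots> \<le> (\<Sum>j\<in>K. measure lebesgue {c j - \<tau>..c j + \<tau>})"
    by (intro measure_UNION_le K) auto
  also have "\<dots> = card K * (2 * \<tau>)"
    using \<open>0 \<le> \<tau>\<close> by simp
  finally show ?thesis .
qed (use \<open>0 \<le> \<tau>\<close> in \<open>simp add: measure_notin_sets\<close>)

lemma sets_fst_le_snd: "{z :: real \<times> real. fst z \<le> snd z} \<in> sets (borel \<Otimes>\<^sub>M borel)"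
proof -
  have "{z \<in> space (borel \<Otimes>\<^sub>M borel :: (real \<times> real) measure). fst z \<le> snd z} \<in> sets (borel \<Otimes>\<^sub>M borel)"
    by measurable
  then show ?thesis
    by (simp add: space_pair_measure)
qed

text \<open>Exchanging the coordinates preserves the product measure and maps \<open>fst z \<le> snd z\<close> to
  \<open>snd z \<le> fst z\<close>; the two events have equal probability and together exhaust the space.\<close>

lemma iid_prob_le_ge_half:
  assumes "real_distribution Q"
  shows "1 / 2 \<le> measure (Q \<Otimes>\<^sub>M Q) {z \<in> space (Q \<Otimes>\<^sub>M Q). fst z \<le> snd z}"
proof -
  interpret Q: real_distribution Q by (rule assms)
  interpret QQ: pair_prob_space Q Q ..
  let ?N = "Q \<Otimes>\<^sub>M Q"
  have [measurable]: "{z \<in> space ?N. fst z \<le> snd z} \<in> sets ?N" "{z \<in> space ?N. snd z \<le> fst z} \<in> sets ?N"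
    by measurable
  have "measure ?N {z \<in> space ?N. fst z \<le> snd z}
      = measure (distr ?N ?N (\<lambda>(x, y). (y, x))) {z \<in> space ?N. fst z \<le> snd z}"
    using QQ.distr_pair_swap by simp
  also have "\<dots> = measure ?N {z \<in> space ?N. snd z \<le> fst z}"
    by (subst measure_distr)
      (auto intro!: measurable_pair_swap' arg_cong[where f = "measure ?N"]
        simp: space_pair_measure sets_fst_le_snd cong: sets_pair_measure_cong)
  finally have swap: "measure ?N {z \<in> space ?N. fst z \<le> snd z} = measure ?N {z \<in> space ?N. snd z \<le> fst z}" .
  have "1 = measure ?N ({z \<in> space ?N. fst z \<le> snd z} \<union> {z \<in> space ?N. snd z \<le> fst z})"
    using QQ.prob_space by (auto intro!: arg_cong[where f = "measure ?N"] simp flip: QQ.prob_space)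
  also have "\<dots> \<le> measure ?N {z \<in> space ?N. fst z \<le> snd z} + measure ?N {z \<in> space ?N. snd z \<le> fst z}"
    by (rule measure_Un_le) measurable
  finally show ?thesis
    using swap by simp
qed

lemma pair_prob_le_eq_integral_cdf:
  assumes "real_distribution P" "real_distribution Q"
  shows "measure (P \<Otimes>\<^sub>M Q) {z \<in> space (P \<Otimes>\<^sub>M Q). fst z \<le> snd z} = (\<integral>y. cdf P y \<partial>Q)"
    and "integrable Q (cdf P)"
proof -
  interpret P: real_distribution P by (rule assms)
  interpret Q: real_distribution Q by (rule assms)
  interpret PQ: pair_prob_space P Q ..
  let ?N = "P \<Otimes>\<^sub>M Q" and ?S = "{z \<in> space (P \<Otimes>\<^sub>M Q). fst z \<le> snd z}"
  have S: "?S \<in> sets ?N"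
    by measurable
  interpret C: cdf_distribution P
    using assms(1) by (simp add: cdf_distribution_def)
  have [measurable]: "cdf P \<in> borel_measurable Q"
    using C.measurable_C by simp
  show int: "integrable Q (cdf P)"
    by (rule Q.integrable_const_bound[where B = 1]) (auto simp: P.cdf_nonneg P.cdf_bounded_prob)
  have "emeasure ?N ?S = (\<integral>\<^sup>+y. emeasure P ((\<lambda>x. (x, y)) -` ?S) \<partial>Q)"
    by (rule PQ.emeasure_pair_measure_alt2[OF S])
  also have "\<dots> = (\<integral>\<^sup>+y. ennreal (cdf P y) \<partial>Q)"
    by (intro nn_integral_cong)
      (auto simp: P.emeasure_eq_measure cdf_def space_pair_measure intro!: arg_cong[where f = "measure P"])
  also have "\<dots> = ennreal (\<integral>y. cdf P y \<partial>Q)"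
    by (intro nn_integral_eq_integral int) (auto simp: P.cdf_nonneg)
  finally show "measure ?N ?S = (\<integral>y. cdf P y \<partial>Q)"
    by (simp add: measure_def integral_nonneg P.cdf_nonneg)
qed

text \<open>Conditioning on the second variable expresses \<open>P(X \<le> Y)\<close> as the integral of the cdf of
  \<open>X\<close> against the law of \<open>Y\<close>. Replacing this cdf by the one of \<open>Y\<close> costs at most \<open>c\<close> and
  leaves the probability for two independent copies of \<open>Y\<close>.\<close>

lemma indep_prob_le_ge:
  assumes M: "prob_space M" and indep: "prob_space.indep_var M borel X borel Y"
    and le: "\<And>x. rv_cdf M Y x - c \<le> rv_cdf M X x"
  shows "1 / 2 - c \<le> measure M {\<omega> \<in> space M. X \<omega> \<le> Y \<omega>}"
proof -
  interpret M: prob_space M by (rule M)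
  let ?P = "distr M borel X" and ?Q = "distr M borel Y"
  have [measurable]: "X \<in> borel_measurable M" "Y \<in> borel_measurable M"
    and joint: "?P \<Otimes>\<^sub>M ?Q = distr M (borel \<Otimes>\<^sub>M borel) (\<lambda>\<omega>. (X \<omega>, Y \<omega>))"
    using indep by (auto simp: M.indep_var_distribution_eq)
  have P: "real_distribution ?P" and Q: "real_distribution ?Q"
    by (auto intro!: real_distribution_distr_borel M)
  interpret Q: real_distribution ?Q by (rule Q)
  have "1 / 2 - c \<le> (\<integral>y. cdf ?Q y \<partial>?Q) - c"
    using iid_prob_le_ge_half[OF Q] pair_prob_le_eq_integral_cdf[OF Q Q] by simp
  also have "\<dots> = (\<integral>y. cdf ?Q y - c \<partial>?Q)"
    using pair_prob_le_eq_integral_cdf(2)[OF Q Q] Q.prob_space by simp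
  also have "\<dots> \<le> (\<integral>y. cdf ?P y \<partial>?Q)"
    using le pair_prob_le_eq_integral_cdf(2)[OF Q Q] pair_prob_le_eq_integral_cdf(2)[OF P Q]
    by (intro integral_mono) (auto simp: rv_cdf_def)
  also have "\<dots> = measure (?P \<Otimes>\<^sub>M ?Q) {z \<in> space (?P \<Otimes>\<^sub>M ?Q). fst z \<le> snd z}"
    by (rule pair_prob_le_eq_integral_cdf(1)[OF P Q, symmetric])
  also have "\<dots> = measure M {\<omega> \<in> space M. X \<omega> \<le> Y \<omega>}"
    unfolding joint
    by (subst measure_distr) (auto intro!: arg_cong[where f = "measure M"]
        simp: space_pair_measure sets_fst_le_snd)
  finally show ?thesis .
qed

section \<open>Asymptotic comparison of mixtures\<close>

theorem theorem7p3:
  fixes F\<^sub>X F\<^sub>Y :: "real \<Rightarrow> real"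
    and s :: nat
    and w :: "nat \<Rightarrow> real"
    and r :: "nat \<Rightarrow> real \<Rightarrow> real"
    and lam :: "nat \<Rightarrow> real"
    and M :: "real \<Rightarrow> 'a measure"
    and X Y :: "real \<Rightarrow> 'a \<Rightarrow> real"
  assumes "is_cdf F\<^sub>X" and "is_cdf F\<^sub>Y"
    and "s \<ge> 1"
    and "s \<noteq> 1 \<Longrightarrow> \<forall>i\<in>{1..s}. w i \<in> {0<..<1}"
    and "s = 1 \<Longrightarrow> w 1 = 1"
    and "(\<Sum>i=1..s. w i) = 1"
    and "\<And>\<alpha>. \<alpha> > 0 \<Longrightarrow> 0 < r 1 \<alpha>"
    and "\<And>\<alpha>. \<alpha> > 0 \<Longrightarrow> strict_mono_on {1..s} (\<lambda>i. r i \<alpha>)"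
    and "\<And>\<alpha>. \<alpha> > 0 \<Longrightarrow> r s \<alpha> < \<alpha> + 1"
    and "\<And>i. i \<in> {1..s} \<Longrightarrow> ((\<lambda>\<alpha>. r i \<alpha> / (\<alpha> + 1)) \<longlongrightarrow> lam i) at_top"
    and "strict_mono_on {1..s} lam"
    and "\<And>\<alpha>. \<alpha> > 0 \<Longrightarrow> prob_space (M \<alpha>)"
    and "\<And>\<alpha>. \<alpha> > 0 \<Longrightarrow> X \<alpha> \<in> borel_measurable (M \<alpha>)"
    and "\<And>\<alpha>. \<alpha> > 0 \<Longrightarrow> Y \<alpha> \<in> borel_measurable (M \<alpha>)"
    and "\<And>\<alpha> x. \<alpha> > 0 \<Longrightarrow>
           rv_cdf (M \<alpha>) (X \<alpha>) x = (\<Sum>i=1..s. w i * phi (r i \<alpha>) \<alpha> (F\<^sub>X x))"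
    and "\<And>\<alpha> x. \<alpha> > 0 \<Longrightarrow>
           rv_cdf (M \<alpha>) (Y \<alpha>) x = (\<Sum>i=1..s. w i * phi (r i \<alpha>) \<alpha> (F\<^sub>Y x))"
    and "Min ((\<lambda>i. dist_to_set (lam i) (quantile_excess F\<^sub>X F\<^sub>Y)) ` {1..s}) > 0"
  shows "ast_le M X Y \<and>
         ((\<forall>\<alpha>>0. prob_space.indep_var (M \<alpha>) borel (X \<alpha>) borel (Y \<alpha>)) \<longrightarrow> asp_le M X Y)"
proof -
  let ?I = "{1..s}" and ?A = "quantile_excess F\<^sub>X F\<^sub>Y"
  note cdfs = assms(1,2) and cdfX = assms(15) and cdfY = assms(16)
  have w: "0 \<le> w i" if "i \<in> ?I" for i
    using assms(4,5) that by (cases "s = 1") (force simp: less_imp_le)+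
  have r: "0 < r i \<alpha>" "r i \<alpha> < \<alpha> + 1" if "\<alpha> > 0" "i \<in> ?I" for i \<alpha>
  proof -
    note mono = strict_mono_on_imp_mono_on[OF assms(8)[OF that(1)]]
    have "r 1 \<alpha> \<le> r i \<alpha>" "r i \<alpha> \<le> r s \<alpha>"
      using that(2) by (auto intro!: mono_onD[OF mono])
    then show "0 < r i \<alpha>" "r i \<alpha> < \<alpha> + 1"
      using assms(7,9)[OF that(1)] by auto
  qed
  obtain d where d: "d > 0" and far: "\<And>i v. i \<in> ?I \<Longrightarrow> v \<in> ?A \<Longrightarrow> d \<le> \<bar>lam i - v\<bar>"
  proof -
    obtain d where d: "0 < ereal d" "ereal d < Min ((\<lambda>i. dist_to_set (lam i) ?A) ` ?I)"
      using ereal_dense2[OF assms(17)] by blast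
    have "d \<le> \<bar>lam i - v\<bar>" if "i \<in> ?I" "v \<in> ?A" for i v
    proof -
      have "ereal d \<le> dist_to_set (lam i) ?A"
        using d(2) that(1) by (auto dest: less_imp_le)
      also have "\<dots> \<le> ereal \<bar>lam i - v\<bar>"
        unfolding dist_to_set_def by (rule INF_lower[OF that(2)])
      finally show ?thesis by simp
    qed
    with d(1) show thesis by (intro that) auto
  qed
  \<comment> \<open>Chebyshev's bound for the tails beyond distance \<open>d / 2\<close> from the mean\<close>
  define \<tau> where "\<tau> \<alpha> = 4 / (d\<^sup>2 * (\<alpha> + 2))" for \<alpha>
  have \<tau>_nonneg: "0 \<le> \<tau> \<alpha>" if "\<alpha> > 0" for \<alpha>
    using that by (simp add: \<tau>_def)
  have \<tau>_lim: "(\<tau> \<longlongrightarrow> 0) at_top"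
    unfolding \<tau>_def using d by real_asymp
  have close: "\<forall>\<^sub>F \<alpha> in at_top. \<forall>i\<in>?I. \<bar>r i \<alpha> / (\<alpha> + 1) - lam i\<bar> < d / 2"
    using d by (intro eventually_ball_finite ballI tendstoD[OF assms(10), unfolded dist_real_def]) auto
  \<comment> \<open>Where the cdfs are in the wrong order, both are close to one of finitely many levels.\<close>
  have gap: "\<exists>J\<subseteq>?I. sum w J - \<tau> \<alpha> \<le> rv_cdf (M \<alpha>) (X \<alpha>) x \<and> rv_cdf (M \<alpha>) (Y \<alpha>) x \<le> sum w J + \<tau> \<alpha>"
    if \<alpha>: "\<alpha> > 0" and cl: "\<forall>i\<in>?I. \<bar>r i \<alpha> / (\<alpha> + 1) - lam i\<bar> < d / 2"
      and less: "rv_cdf (M \<alpha>) (X \<alpha>) x < rv_cdf (M \<alpha>) (Y \<alpha>) x" for \<alpha> x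
  proof -
    note bX = is_cdf_bounds[OF cdfs(1), of x] and bY = is_cdf_bounds[OF cdfs(2), of x]
    have pq: "F\<^sub>X x < F\<^sub>Y x"
    proof (rule ccontr)
      assume "\<not> F\<^sub>X x < F\<^sub>Y x"
      then have "rv_cdf (M \<alpha>) (Y \<alpha>) x \<le> rv_cdf (M \<alpha>) (X \<alpha>) x"
        unfolding cdfX[OF \<alpha>] cdfY[OF \<alpha>] using bX bY
        by (intro sum_mono mult_left_mono phi_mono r[OF \<alpha>] w) auto
      with less show False by simp
    qed
    have "v \<in> ?A" if "F\<^sub>X x < v" "v < F\<^sub>Y x" for v
      unfolding mem_quantile_excess_iff[OF cdfs] using that bX bY
      by (intro conjI exI[of _ x]) auto
    then show ?thesis
      unfolding cdfX[OF \<alpha>] cdfY[OF \<alpha>] \<tau>_def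
      by (intro phi_mixture_almost_constant[where lam = lam] r \<alpha> w d)
        (use cl bX bY pq far assms(6) in auto)
  qed
  have "ast_le M X Y"
    unfolding ast_le_def
  proof (rule tendsto_sandwich)
    show "((\<lambda>_. 0) \<longlongrightarrow> 0) at_top" by simp
    show "((\<lambda>\<alpha>. card (Pow ?I) * (2 * \<tau> \<alpha>)) \<longlongrightarrow> 0) at_top"
      by (intro tendsto_mult_right_zero \<tau>_lim)
    show "\<forall>\<^sub>F \<alpha> in at_top. measure lebesgue (quantile_excess (rv_cdf (M \<alpha>) (X \<alpha>)) (rv_cdf (M \<alpha>) (Y \<alpha>)))
            \<le> card (Pow ?I) * (2 * \<tau> \<alpha>)"
      using close eventually_gt_at_top[of 0]
    proof eventually_elim
      case (elim \<alpha>)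
      then have \<alpha>: "\<alpha> > 0" by simp
      note excess = mem_quantile_excess_iff[OF
          is_cdf_rv_cdf[OF assms(12)[OF \<alpha>] assms(13)[OF \<alpha>]]
          is_cdf_rv_cdf[OF assms(12)[OF \<alpha>] assms(14)[OF \<alpha>]]]
      show ?case
      proof (rule measure_le_UN_intervals)
        show "quantile_excess (rv_cdf (M \<alpha>) (X \<alpha>)) (rv_cdf (M \<alpha>) (Y \<alpha>))
            \<subseteq> (\<Union>J\<in>Pow ?I. {sum w J - \<tau> \<alpha>..sum w J + \<tau> \<alpha>})"
        proof
          fix u assume "u \<in> quantile_excess (rv_cdf (M \<alpha>) (X \<alpha>)) (rv_cdf (M \<alpha>) (Y \<alpha>))"
          then obtain x where x: "rv_cdf (M \<alpha>) (X \<alpha>) x < u" "u \<le> rv_cdf (M \<alpha>) (Y \<alpha>) x"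
            by (auto simp: excess)
          then obtain J where "J \<in> Pow ?I" "sum w J - \<tau> \<alpha> \<le> u" "u \<le> sum w J + \<tau> \<alpha>"
            using gap[OF \<alpha> elim(1), of x] by (meson PowI less_le_trans less_imp_le order_trans)
          then show "u \<in> (\<Union>J\<in>Pow ?I. {sum w J - \<tau> \<alpha>..sum w J + \<tau> \<alpha>})"
            by (intro UN_I) auto
        qed
      qed (use \<tau>_nonneg[OF \<alpha>] in auto)
    qed
  qed simp
  moreover have "asp_le M X Y" if indep: "\<forall>\<alpha>>0. prob_space.indep_var (M \<alpha>) borel (X \<alpha>) borel (Y \<alpha>)"
  proof -
    let ?P = "\<lambda>\<alpha>. measure (M \<alpha>) {\<omega> \<in> space (M \<alpha>). X \<alpha> \<omega> \<le> Y \<alpha> \<omega>}"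
    have "\<forall>\<^sub>F \<alpha> in at_top. ereal (1 / 2 - 2 * \<tau> \<alpha>) \<le> ereal (?P \<alpha>)"
      using close eventually_gt_at_top[of 0]
    proof eventually_elim
      case (elim \<alpha>)
      then have \<alpha>: "\<alpha> > 0" by simp
      have "rv_cdf (M \<alpha>) (Y \<alpha>) x - 2 * \<tau> \<alpha> \<le> rv_cdf (M \<alpha>) (X \<alpha>) x" for x
      proof (cases "rv_cdf (M \<alpha>) (X \<alpha>) x < rv_cdf (M \<alpha>) (Y \<alpha>) x")
        case True
        from gap[OF \<alpha> elim(1) this] show ?thesis by auto
      qed (use \<tau>_nonneg[OF \<alpha>] in auto)
      then show ?case
        using indep_prob_le_ge[OF assms(12)[OF \<alpha>]] indep \<alpha> by simp
    qed
    then have "Liminf at_top (\<lambda>\<alpha>. ereal (1 / 2 - 2 * \<tau> \<alpha>)) \<le> Liminf at_top (\<lambda>\<alpha>. ereal (?P \<alpha>))"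
      by (rule Liminf_mono)
    moreover have "((\<lambda>\<alpha>. ereal (1 / 2 - 2 * \<tau> \<alpha>)) \<longlongrightarrow> ereal (1 / 2 - 2 * 0)) at_top"
      by (intro tendsto_intros \<tau>_lim)
    then have "Liminf at_top (\<lambda>\<alpha>. ereal (1 / 2 - 2 * \<tau> \<alpha>)) = ereal (1 / 2)"
      by (intro lim_imp_Liminf) auto
    ultimately show ?thesis
      by (simp add: asp_le_def)
  qed
  ultimately show ?thesis by blast
qed

end
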